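(* ALSO-X# is better than its weak version ALSO-X$\underline{\#}$, i.e., $v^{A\#}\le v^{A\underline{\#}}$.
   Context: Data. $n,m,I$ are positive integers, $[I]=\{1,\dots,I\}$, $\mathcal X\subseteq\mathbb{R}^n$ is a deterministic set (not assumed convex), $c\in\mathbb{R}^n$, $\varepsilon\in(0,1)$, $\theta\ge 0$, $\|\cdot\|$ is a norm on $\mathbb{R}^m$ with dual norm $\|\cdot\|_*$. For $i\in[I]$, $a_i(x)=A_ix+a_i\in\mathbb{R}^m$ and $b_i(x)=B_i^\top x+b_i\in\mathbb{R}$ are affine. $\tilde\zeta$ is a random vector in $\mathbb{R}^m$ with reference distribution $\mathbb{P}_\zeta$, assumed sub-Gaussian: $\mathbb{P}_\zeta\{\|\tilde\zeta\|\ge\tau\}\le C_1\exp(-C_2\tau^2)$ for some constants $C_1,C_2>0$. $(y)_+=\max\{y,0\}$. Put $$g(x,\zeta)=\max_{i\in[I]}\big(\theta\|a_i(x)\|_*+a_i(x)^\top\zeta-b_i(x)\big).$$ The underlying problem (DRCCP under the type $\infty$-Wasserstein ambiguity set) is $\min\{c^\top x: x\in\mathcal X,\ \mathbb{P}_\zeta\{g(x,\tilde\zeta)\le0\}\ge1-\varepsilon\}$. ALSO-X#: $v^{A\#}$ is the minimum (infimum) of all $t$ (with $t\ge\min_{x\in\mathcal X}c^\top x$) for which there is $(x^*,\beta^* )\in\arg\min\{\varepsilon\beta+\mathbb{E}_{\mathbb{P}_\zeta}[(g(x,\tilde\zeta)-\beta)_+]: x\in\mathcal X,\ c^\top x\le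 t,\ \beta\le0\}$ with $\mathbb{P}_\zeta\{g(x^*,\tilde\zeta)\le0\}\ge1-\varepsilon$. ALSO-X$\underline{\#}$ (the same without the constraint $\beta\le 0$): $v^{A\underline{\#}}$ is the minimum (infimum) of all $t$ (with $t\ge\min_{x\in\mathcal X}c^\top x$) for which there is $(x^*,\beta^* )\in\arg\min\{\varepsilon\beta+\mathbb{E}_{\mathbb{P}_\zeta}[(g(x,\tilde\zeta)-\beta)_+]: x\in\mathcal X,\ c^\top x\le t,\ \beta\in\mathbb{R}\}$ with $\mathbb{P}_\zeta\{g(x^*,\tilde\zeta)\le0\}\ge1-\varepsilon$. Conventions: an infimum over the empty set is $+\infty$; the lower-level minimization problems (written with $\arg\min$) are understood to attain their minimum whenever they are feasible. *)

theory Defs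
  imports "HOL-Probability.Probability"
begin

definition is_norm :: "('a::real_vector \<Rightarrow> real) \<Rightarrow> bool" where
  "is_norm N \<longleftrightarrow>
     (\<forall>x. 0 \<le> N x) \<and> (\<forall>x. N x = 0 \<longleftrightarrow> x = 0) \<and>
     (\<forall>s x. N (s *\<^sub>R x) = \<bar>s\<bar> * N x) \<and> (\<forall>x y. N (x + y) \<le> N x + N y)"

definition dual_norm :: "('a::real_inner \<Rightarrow> real) \<Rightarrow> 'a \<Rightarrow> real" where
  "dual_norm N y = (SUP z\<in>{z. N z \<le> 1}. y \<bullet> z)"

(* The tail bound is required for tau >= 0 only: for tau -> -infinity the left-hand side
   is 1 while the right-hand side tends to 0. *)
definition sub_gaussian :: "('a::real_vector \<Rightarrow> real) \<Rightarrow> 'a measure \<Rightarrow> bool" where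
  "sub_gaussian N P \<longleftrightarrow>
     (\<exists>C1>0. \<exists>C2>0. \<forall>\<tau>\<ge>0. \<P>(z in P. N z \<ge> \<tau>) \<le> C1 * exp (- C2 * \<tau>\<^sup>2))"

definition constraint_fun ::
  "real \<Rightarrow> (real^'m \<Rightarrow> real) \<Rightarrow> nat \<Rightarrow> (nat \<Rightarrow> real^'n^'m) \<Rightarrow> (nat \<Rightarrow> real^'m) \<Rightarrow>
   (nat \<Rightarrow> real^'n) \<Rightarrow> (nat \<Rightarrow> real) \<Rightarrow> real^'n \<Rightarrow> real^'m \<Rightarrow> real" where
  "constraint_fun \<theta> N I A a B b x z =
     (MAX i\<in>{1..I}. \<theta> * dual_norm N (A i *v x + a i) + (A i *v x + a i) \<bullet> z - (B i \<bullet> x + b i))"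

definition lower_objective ::
  "'z measure \<Rightarrow> real \<Rightarrow> ('x \<Rightarrow> 'z \<Rightarrow> real) \<Rightarrow> 'x \<times> real \<Rightarrow> real" where
  "lower_objective P \<epsilon> g = (\<lambda>(x, \<beta>). \<epsilon> * \<beta> + (\<integral>z. max (g x z - \<beta>) 0 \<partial>P))"

(* S is the range of beta: {..0} gives ALSO-X#, UNIV gives its weak version. *)
definition lower_argmin ::
  "real set \<Rightarrow> 'z measure \<Rightarrow> real \<Rightarrow> ('x::real_inner \<Rightarrow> 'z \<Rightarrow> real) \<Rightarrow> 'x set \<Rightarrow> 'x \<Rightarrow> real \<Rightarrow>
   ('x \<times> real) set" where
  "lower_argmin S P \<epsilon> g X c t =
     {p. is_arg_min (lower_objective P \<epsilon> g) (\<lambda>(x, \<beta>). x \<in> X \<and> c \<bullet> x \<le> t \<and> \<beta> \<in> S) p}"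

definition alsox_value ::
  "real set \<Rightarrow> 'z measure \<Rightarrow> real \<Rightarrow> ('x::real_inner \<Rightarrow> 'z \<Rightarrow> real) \<Rightarrow> 'x set \<Rightarrow> 'x \<Rightarrow> ereal" where
  "alsox_value S P \<epsilon> g X c =
     Inf (ereal ` {t. (INF x\<in>X. ereal (c \<bullet> x)) \<le> ereal t \<and>
                      (\<exists>(x, \<beta>) \<in> lower_argmin S P \<epsilon> g X c t. \<P>(z in P. g x z \<le> 0) \<ge> 1 - \<epsilon>)})"

definition alsox_sharp ::
  "'z measure \<Rightarrow> real \<Rightarrow> ('x::real_inner \<Rightarrow> 'z \<Rightarrow> real) \<Rightarrow> 'x set \<Rightarrow> 'x \<Rightarrow> ereal" where
  "alsox_sharp = alsox_value {..0}"

definition alsox_sharp_weak ::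
  "'z measure \<Rightarrow> real \<Rightarrow> ('x::real_inner \<Rightarrow> 'z \<Rightarrow> real) \<Rightarrow> 'x set \<Rightarrow> 'x \<Rightarrow> ereal" where
  "alsox_sharp_weak = alsox_value UNIV"

(* Whenever the lower-level problem at level t is feasible, its minimum is attained. *)
definition lower_attained ::
  "real set \<Rightarrow> 'z measure \<Rightarrow> real \<Rightarrow> ('x::real_inner \<Rightarrow> 'z \<Rightarrow> real) \<Rightarrow> 'x set \<Rightarrow> 'x \<Rightarrow> bool" where
  "lower_attained S P \<epsilon> g X c \<longleftrightarrow>
     (\<forall>t. (\<exists>x\<in>X. c \<bullet> x \<le> t) \<longrightarrow> lower_argmin S P \<epsilon> g X c t \<noteq> {})"

end

theory Submission
  imports Defs
begin

text \<open>For fixed \<^term>\<open>x\<close> and integrable \<^term>\<open>g\<close>, the lower-level objective is convex in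
  \<^term>\<open>\<beta>\<close>, and its right derivative at \<^term>\<open>\<beta>\<close> is \<open>\<epsilon> - \<P>(g > \<beta>)\<close>. The chance constraint \<open>\<P>(g \<le> 0) \<ge> 1 - \<epsilon>\<close> makes this
  derivative nonnegative on the half-line \<open>\<beta> \<ge> 0\<close>: a positive \<^term>\<open>\<beta>\<close> lies above the
  \<open>(1 - \<epsilon>)\<close>-quantile of \<^term>\<open>g\<close>, so lowering it to zero cannot increase the objective
  (\<open>lower_objective_min_zero_le\<close>). Hence a minimizer \<open>(x, \<beta>)\<close> of the unconstrained problem whose
  \<^term>\<open>x\<close> satisfies the chance constraint gives the minimizer \<open>(x, min \<beta> 0)\<close>, which is
  admissible for the problem with \<open>\<beta> \<le> 0\<close> and therefore optimal there as well. Every level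
  accepted by the weak version is thus accepted by ALSO-X\<open>#\<close>, and the infimum over the larger set
  of levels is the smaller one.\<close>

text \<open>Trading the shift \<^term>\<open>\<beta>\<close> for a constant pays off only on the event that \<^term>\<open>h\<close> is
  positive, whence the probability of that event as the factor. When the positive part of
  \<^term>\<open>h\<close> is not integrable, neither is the shifted one, as the two differ by at most
  \<^term>\<open>\<beta>\<close>; both Bochner integrals then have the default value zero and the bound persists.\<close>

lemma (in prob_space) expectation_pos_part_shift_le:
  fixes h :: "'a \<Rightarrow> real"
  assumes [measurable]: "h \<in> borel_measurable M" and "0 \<le> \<beta>"
  shows "expectation (\<lambda>z. max (h z) 0)
           \<le> expectation (\<lambda>z. max (h z - \<beta>) 0) + \<beta> * \<P>(z in M. h z > 0)"
proof (cases "integrable M (\<lambda>z. max (h z - \<beta>) 0)")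
  case True
  have ind: "integrable M (\<lambda>z. \<beta> * indicator {z \<in> space M. h z > 0} z)"
    by (intro integrable_mult_right integrable_real_indicator) (auto simp: emeasure_eq_measure)
  have "expectation (\<lambda>z. max (h z) 0)
          \<le> expectation (\<lambda>z. max (h z - \<beta>) 0 + \<beta> * indicator {z \<in> space M. h z > 0} z)"
    using True ind \<open>0 \<le> \<beta>\<close>
    by (intro integral_mono') (auto simp: indicator_def)
  also have "\<dots> = expectation (\<lambda>z. max (h z - \<beta>) 0) + \<beta> * \<P>(z in M. h z > 0)"
    using True ind by (simp add: Int_absorb1)
  finally show ?thesis .
next
  case False
  have "\<not> integrable M (\<lambda>z. max (h z) 0)"
  proof
    assume "integrable M (\<lambda>z. max (h z) 0)"
    then have "integrable M (\<lambda>z. max (h z - \<beta>) 0)"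
      by (rule Bochner_Integration.integrable_bound) (use \<open>0 \<le> \<beta>\<close> in auto)
    with False show False ..
  qed
  with False \<open>0 \<le> \<beta>\<close> show ?thesis
    by (simp add: not_integrable_integral_eq)
qed

lemma (in prob_space) lower_objective_min_zero_le:
  fixes g :: "'x \<Rightarrow> 'a \<Rightarrow> real"
  assumes [measurable]: "g x \<in> borel_measurable M"
    and chance: "\<P>(z in M. g x z \<le> 0) \<ge> 1 - \<epsilon>"
  shows "lower_objective M \<epsilon> g (x, min \<beta> 0) \<le> lower_objective M \<epsilon> g (x, \<beta>)"
proof (cases "\<beta> \<le> 0")
  case True
  then show ?thesis by (simp add: min_def)
next
  case False
  have "\<P>(z in M. g x z > 0) = 1 - \<P>(z in M. g x z \<le> 0)"
    using prob_neg[of "\<lambda>z. g x z \<le> 0"] by (simp add: not_le)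
  then have "\<beta> * \<P>(z in M. g x z > 0) \<le> \<beta> * \<epsilon>"
    using chance False by (intro mult_left_mono) auto
  moreover have "expectation (\<lambda>z. max (g x z) 0)
      \<le> expectation (\<lambda>z. max (g x z - \<beta>) 0) + \<beta> * \<P>(z in M. g x z > 0)"
    using False by (intro expectation_pos_part_shift_le) auto
  ultimately have "expectation (\<lambda>z. max (g x z) 0)
      \<le> \<epsilon> * \<beta> + expectation (\<lambda>z. max (g x z - \<beta>) 0)"
    unfolding mult.commute[of \<epsilon>] by linarith
  then show ?thesis
    using False by (simp add: lower_objective_def min_def)
qed

text \<open>Truncating the shift of an unconstrained minimizer at zero keeps its value minimal over all
  shifts, a fortiori over the nonpositive ones, and it leaves \<^term>\<open>x\<close> and with it both the level
  and the chance constraint unchanged.\<close>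

lemma (in prob_space) alsox_sharp_le_alsox_sharp_weak:
  fixes g :: "'x::real_inner \<Rightarrow> 'a \<Rightarrow> real"
  assumes "\<And>x. g x \<in> borel_measurable M"
  shows "alsox_sharp M \<epsilon> g X c \<le> alsox_sharp_weak M \<epsilon> g X c"
proof -
  have "(x, min \<beta> 0) \<in> lower_argmin {..0} M \<epsilon> g X c t"
    if "(x, \<beta>) \<in> lower_argmin UNIV M \<epsilon> g X c t" and "\<P>(z in M. g x z \<le> 0) \<ge> 1 - \<epsilon>"
    for x \<beta> t
    using that lower_objective_min_zero_le[of g x \<epsilon> \<beta>, OF assms that(2)]
    by (auto simp: lower_argmin_def is_arg_min_linorder intro: order_trans)
  then show ?thesis
    unfolding alsox_sharp_def alsox_sharp_weak_def alsox_value_def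
    by (intro Inf_superset_mono image_mono) blast
qed

lemma borel_measurable_constraint_fun:
  assumes "sets P = sets borel"
  shows "constraint_fun \<theta> N I A a B b x \<in> borel_measurable P"
proof -
  have "constraint_fun \<theta> N I A a B b x \<in> borel_measurable borel"
    unfolding constraint_fun_def by measurable
  then show ?thesis
    using assms measurable_cong_sets by blast
qed

theorem theorem2:
  fixes X :: "(real^'n) set" and c :: "real^'n"
    and \<epsilon> \<theta> :: real and N :: "real^'m \<Rightarrow> real" and I :: nat
    and A :: "nat \<Rightarrow> real^'n^'m" and a :: "nat \<Rightarrow> real^'m"
    and B :: "nat \<Rightarrow> real^'n" and b :: "nat \<Rightarrow> real"
    and P :: "(real^'m) measure"
    and g :: "real^'n \<Rightarrow> real^'m \<Rightarrow> real"
  defines "g \<equiv> constraint_fun \<theta> N I A a B b"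
  assumes "I \<ge> 1" and "0 < \<epsilon>" and "\<epsilon> < 1" and "\<theta> \<ge> 0"
    and "is_norm N"
    and "prob_space P" and "sets P = sets borel" and "sub_gaussian N P"
    and "lower_attained {..0} P \<epsilon> g X c"
    and "lower_attained UNIV P \<epsilon> g X c"
  shows "alsox_sharp P \<epsilon> g X c \<le> alsox_sharp_weak P \<epsilon> g X c"
  unfolding g_def
  by (intro prob_space.alsox_sharp_le_alsox_sharp_weak[OF \<open>prob_space P\<close>]
      borel_measurable_constraint_fun \<open>sets P = sets borel\<close>)

end
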